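(* Let $p\in[0,1)$, $q>0$, and let $\mu$ be a Borel probability measure on $S^{n-1}$ (so $|\mu|=1$, hence $|\overline\mu_m|=1$) not concentrated in any closed hemisphere, with $\overline\mu_m$, $\Omega_m$ constructed as in the context. For each (sufficiently large) $m$ let $z^m\in\mathbb R^{\mathcal N_m}_+$ satisfy $\xi_{p,\overline\mu_m}(z^m)=o$, $I_q([z^m,\Omega_m])=1$, and $$\Phi_{p,\overline\mu_m}(z^m,o)=\inf\{\Phi_{p,\overline\mu_m}(z,\xi_{p,\overline\mu_m}(z)): z\in\mathbb R^{\mathcal N_m},\ I_q([z,\Omega_m])=1\},$$ and let $P_m=\big(\Phi_{p,\overline\mu_m}(z^m,o)/(n+q-1)\big)^{1/(n+q-p-1)}[z^m,\Omega_m]$ if $p\in(0,1)$ and $P_m=(n+q-1)^{-1/(n+q-1)}[z^m,\Omega_m]$ if $p=0$. Then there exists $c_0>0$ independent of $m$ such that $\Phi_{p,\overline\mu_m}(P_m,o)<c_0$ for all such $m$.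
   Context: Work in $\mathbb R^n$, $n\ge2$; $\omega_n$ is the volume of the unit ball. Construction: for each $m$, $U_{1,m},\dots,U_{\mathcal N_m,m}$ is a partition of $S^{n-1}$ into Borel sets of diameter $<1/m$ with nonempty relative interior, $v_{i,m}\in U_{i,m}$ in general position in dimension $n$, $\Omega_m=\{v_{1,m},\dots,v_{\mathcal N_m,m}\}$, $\mu_m=\sum_i(\mu(U_{i,m})+\mathcal N_m^{-2})\delta_{v_{i,m}}$, $\overline\mu_m=\frac{|\mu|}{|\mu_m|}\mu_m$; write $\overline\mu_m=\sum_i\alpha_{i,m}\delta_{v_{i,m}}$. For $z\in\mathbb R^{\mathcal N_m}$, $[z,\Omega_m]=\{x: x\cdot v_{i,m}\le z_i\ \forall i\}$; $\mathbb R^N_+$ is the set of vectors with positive coordinates. For $\xi\in[z,\Omega_m]$: $\Phi_{p,\overline\mu_m}(z,\xi)=\sum_i(z_i-\xi\cdot v_{i,m})^p\alpha_{i,m}$ for $p\in(0,1)$ and $\sum_i\alpha_{i,m}\log(z_i-\xi\cdot v_{i,m})$ for $p=0$; $\xi_{p,\overline\mu_m}(z)$ is the unique maximizer of $\Phi_{p,\overline\mu_m}(z,\cdot)$ on $[z,\Omega_m]$ when the latter has nonempty interior. For a convex body $K$ and $\xi\in K$, $\Phi_{p,\nu}(K,\xi)=\int_{S^{n-1}}h_{K-\xi}^p\,d\nu$ if $p\in(0,1)$ and $\int_{S^{n-1}}\log h_{K-\xi}\,d\nu$ if $p=0$, where $h_K(v)=\max_{x\in K}x\cdot v$. Chord integral: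 for compact convex $K$ and $z\in K$, $\rho_{K,z}(u)=\max\{t\ge0:z+tu\in K\}$, $\widetilde V_s(K,z)=\frac1n\int_{\{\rho_{K,z}>0\}}\rho_{K,z}^s\,du$, $I_q(K)=\frac q{\omega_n}\int_K\widetilde V_{q-1}(K,z)\,dz$. *)

theory Defs
  imports "HOL-Probability.Probability"
begin

section \<open>Polytopes [z, Omega_m]\<close>

definition polyt :: "nat \<Rightarrow> (nat \<Rightarrow> 'a::euclidean_space) \<Rightarrow> (nat \<Rightarrow> real) \<Rightarrow> 'a set" where
  "polyt N v z = {x. \<forall>i<N. x \<bullet> v i \<le> z i}"

section \<open>Discrete functional Phi_{p,mubar_m}(z, xi); value -infinity encodes log 0 for p = 0\<close>

definition Phi_disc :: "real \<Rightarrow> nat \<Rightarrow> (nat \<Rightarrow> real) \<Rightarrow> (nat \<Rightarrow> 'a::euclidean_space)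
    \<Rightarrow> (nat \<Rightarrow> real) \<Rightarrow> 'a \<Rightarrow> ereal" where
  "Phi_disc p N \<alpha> v z \<xi> =
     (if p = 0 then
        (if (\<forall>i<N. z i - \<xi> \<bullet> v i > 0)
         then ereal (\<Sum>i<N. \<alpha> i * ln (z i - \<xi> \<bullet> v i)) else -\<infinity>)
      else ereal (\<Sum>i<N. (z i - \<xi> \<bullet> v i) powr p * \<alpha> i))"

text \<open>The (unique) maximiser of Phi_disc over the polytope.\<close>
definition xi_max :: "real \<Rightarrow> nat \<Rightarrow> (nat \<Rightarrow> real) \<Rightarrow> (nat \<Rightarrow> 'a::euclidean_space)
    \<Rightarrow> (nat \<Rightarrow> real) \<Rightarrow> 'a" where
  "xi_max p N \<alpha> v z = (THE \<xi>. \<xi> \<in> polyt N v z \<and>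
      (\<forall>\<eta>\<in>polyt N v z. Phi_disc p N \<alpha> v z \<eta> \<le> Phi_disc p N \<alpha> v z \<xi>))"

section \<open>Weights of the normalised discrete measure mubar_m\<close>

definition alpha_w :: "'a measure \<Rightarrow> (nat \<Rightarrow> nat \<Rightarrow> 'a set) \<Rightarrow> (nat \<Rightarrow> nat) \<Rightarrow> nat \<Rightarrow> nat \<Rightarrow> real" where
  "alpha_w \<mu> U N m i =
     measure \<mu> (space \<mu>) / (\<Sum>j<N m. measure \<mu> (U m j) + 1 / (real (N m))\<^sup>2)
       * (measure \<mu> (U m i) + 1 / (real (N m))\<^sup>2)"

section \<open>General position: any n of the vectors are linearly independent\<close>

definition gen_pos :: "nat \<Rightarrow> (nat \<Rightarrow> 'a::euclidean_space) \<Rightarrow> bool" where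
  "gen_pos N v \<longleftrightarrow> (\<forall>I\<subseteq>{..<N}. card I \<le> DIM('a) \<longrightarrow> inj_on v I \<and> independent (v ` I))"

section \<open>Support function and Phi_{p,nu}(K, xi) for the discrete measure nu = sum alpha_i delta_{v_i}\<close>

definition supp_fun :: "'a::euclidean_space set \<Rightarrow> 'a \<Rightarrow> real" where
  "supp_fun K u = Sup ((\<lambda>x. x \<bullet> u) ` K)"

definition Phi_body :: "real \<Rightarrow> nat \<Rightarrow> (nat \<Rightarrow> real) \<Rightarrow> (nat \<Rightarrow> 'a::euclidean_space)
    \<Rightarrow> 'a set \<Rightarrow> 'a \<Rightarrow> real" where
  "Phi_body p N \<alpha> v K \<xi> =
     (if p = 0 then (\<Sum>i<N. \<alpha> i * ln (supp_fun ((\<lambda>x. x - \<xi>) ` K) (v i)))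
      else (\<Sum>i<N. (supp_fun ((\<lambda>x. x - \<xi>) ` K) (v i)) powr p * \<alpha> i))"

section \<open>Chord integrals\<close>

definition radial :: "'a::euclidean_space set \<Rightarrow> 'a \<Rightarrow> 'a \<Rightarrow> real" where
  "radial K z u = Sup {t. t \<ge> 0 \<and> z + t *\<^sub>R u \<in> K}"

text \<open>Integral over the unit sphere w.r.t. spherical Lebesgue measure, via the cone
  identity  sigma(A) = n * lambda({t u : u in A, 0 < t <= 1}).\<close>
definition sphere_int :: "('a::euclidean_space \<Rightarrow> ennreal) \<Rightarrow> ennreal" where
  "sphere_int f = ennreal (real DIM('a)) *
     (\<integral>\<^sup>+ x. f ((1 / norm x) *\<^sub>R x) * indicator (ball 0 1) x \<partial>lborel)"

definition dual_qvol :: "real \<Rightarrow> 'a::euclidean_space set \<Rightarrow> 'a \<Rightarrow> ennreal" where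
  "dual_qvol s K z = ennreal (1 / real DIM('a)) *
     sphere_int (\<lambda>u. if radial K z u > 0 then ennreal (radial K z u powr s) else 0)"

definition chord_int :: "real \<Rightarrow> 'a::euclidean_space set \<Rightarrow> ennreal" where
  "chord_int q K = ennreal (q / measure lborel (ball (0::'a) 1)) *
     (\<integral>\<^sup>+ z. dual_qvol (q - 1) K z * indicator K z \<partial>lborel)"

end

theory Submission
  imports Defs
begin

(* The normals v_i of Omega_m are unit vectors, and once the cells have diameter < 1 they form a
   1/2-net of the sphere, so the polytope P(r) = [(r, ..., r), Omega_m] lies between the balls of
   radii r and 2r. The chord integral I_q is homogeneous of degree n + q - 1 and, on convex bodies
   between the balls of radii 1 and 2, bounded below and finite; hence I_q(P(r)) = 1 for some
   r <= R with R independent of m. The maximiser xi of Phi(P(r), .) lies in P(r), so every gap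
   r - xi . v_i is at most 3r and Phi(P(r), xi) <= phi_p(3R). Minimality of z^m turns this into a
   bound on Phi(z^m, o) uniform in m, and since h_{c [z, Omega]}(v_i) <= c z_i, Phi(P_m, o) is at
   most c^p Phi(z^m, o), resp. ln c + Phi(z^m, o), for the normalising factor c. *)

section \<open>Strict midpoint concavity of powers and logarithm\<close>

lemma powr_less_tangent_at_1:
  fixes p x :: real
  assumes p: "0 < p" "p < 1" and x: "0 \<le> x" "x \<noteq> 1"
  shows "x powr p < 1 + p * (x - 1)"
proof (cases "x = 0")
  case True then show ?thesis using p by simp
next
  case False
  then have xp: "x > 0" using x by simp
  define f where "f t = t powr p - p * t" for t :: real
  define f' where "f' t = p * t powr (p - 1) - p" for t :: real
  have der: "DERIV f t :> f' t" if "t > 0" for t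
    unfolding f_def f'_def using that
    by (auto intro!: derivative_eq_intros has_real_derivative_powr)
  show ?thesis
  proof (cases "x > 1")
    case True
    obtain y where y: "1 < y" "y < x" "f x - f 1 = (x - 1) * f' y"
      using MVT2[OF True, of f f'] der by force
    have "y powr (p - 1) < 1 powr (p - 1)"
      using y p by (intro powr_less_mono2_neg) auto
    then have "f' y < 0" using p by (simp add: f'_def)
    then have "f x - f 1 < 0" using y True by (simp add: mult_pos_neg)
    then show ?thesis by (simp add: f_def algebra_simps)
  next
    case False
    then have x1: "x < 1" using x by simp
    obtain y where y: "x < y" "y < 1" "f 1 - f x = (1 - x) * f' y"
      using MVT2[OF x1, of f f'] der xp by force
    have "1 powr (p - 1) < y powr (p - 1)"
      using y p xp by (intro powr_less_mono2_neg) auto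
    then have "f' y > 0" using p by (simp add: f'_def)
    then have "f 1 - f x > 0" using y x1 by simp
    then show ?thesis by (simp add: f_def algebra_simps)
  qed
qed

lemma powr_midpoint_strict:
  fixes a b p :: real
  assumes p: "0 < p" "p < 1" and ab: "0 \<le> a" "0 \<le> b" "a \<noteq> b"
  shows "(a powr p + b powr p) / 2 < ((a + b) / 2) powr p"
proof -
  define c where "c = (a + b) / 2"
  have c: "c > 0" using ab by (simp add: c_def)
  have "a / c \<noteq> 1" "b / c \<noteq> 1" using ab c by (auto simp: c_def field_simps)
  then have "(a / c) powr p < 1 + p * (a / c - 1)" "(b / c) powr p < 1 + p * (b / c - 1)"
    using ab c p by (auto intro!: powr_less_tangent_at_1)
  then have "(a / c) powr p + (b / c) powr p < 2 + p * ((a + b) / c - 2)"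
    by (simp add: algebra_simps add_divide_distrib)
  also have "(a + b) / c = 2" using c by (simp add: c_def field_simps)
  finally have "(a powr p + b powr p) / c powr p < 2"
    using ab c by (simp add: powr_divide add_divide_distrib)
  then show ?thesis using c by (simp add: c_def divide_less_eq)
qed

lemma ln_midpoint_strict:
  fixes a b :: real
  assumes "0 < a" "0 < b" "a \<noteq> b"
  shows "(ln a + ln b) / 2 < ln ((a + b) / 2)"
proof -
  have "0 < (a - b)^2" using assms by simp
  then have "a * b < ((a + b) / 2)^2" by (simp add: power2_eq_square field_simps)
  then have "ln (a * b) < ln (((a + b) / 2)^2)" using assms by simp
  then show ?thesis using assms by (simp add: ln_mult ln_realpow)
qed

lemma sum_midpoint_strict:
  fixes f :: "real \<Rightarrow> real"
  assumes mid: "\<And>x y. x \<in> S \<Longrightarrow> y \<in> S \<Longrightarrow> x \<noteq> y \<Longrightarrow> (f x + f y) / 2 < f ((x + y) / 2)"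
    and I: "finite I" "i0 \<in> I" "a i0 \<noteq> b i0"
    and ab: "\<And>i. i \<in> I \<Longrightarrow> a i \<in> S \<and> b i \<in> S \<and> w i > 0"
  shows "(\<Sum>i\<in>I. w i * f (a i)) + (\<Sum>i\<in>I. w i * f (b i)) < 2 * (\<Sum>i\<in>I. w i * f ((a i + b i) / 2))"
proof -
  have le: "w i * ((f (a i) + f (b i)) / 2) \<le> w i * f ((a i + b i) / 2)" if "i \<in> I" for i
    using mid[of "a i" "b i"] ab[OF that] by (cases "a i = b i") (auto simp: mult_left_mono)
  have "(\<Sum>i\<in>I. w i * ((f (a i) + f (b i)) / 2)) < (\<Sum>i\<in>I. w i * f ((a i + b i) / 2))"
    using I ab[OF I(2)] le mid[of "a i0" "b i0"]
    by (intro sum_strict_mono_ex1) (auto intro!: bexI[of _ i0])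
  then show ?thesis
    by (simp add: sum.distrib sum_distrib_left[symmetric] algebra_simps sum_divide_distrib[symmetric])
qed

section \<open>The polytopes [z, Omega]\<close>

definition half_net :: "nat \<Rightarrow> (nat \<Rightarrow> 'a::real_inner) \<Rightarrow> bool" where
  "half_net N v \<longleftrightarrow> (\<forall>u\<in>sphere 0 1. \<exists>i<N. u \<bullet> v i > 1/2)"

lemma polyt_eq_INT_halfspaces: "polyt N v z = (\<Inter>i<N. {x. v i \<bullet> x \<le> z i})"
  by (auto simp: polyt_def inner_commute)

lemma polyt_convex: "convex (polyt N v z)"
  unfolding polyt_eq_INT_halfspaces by (intro convex_INT) (auto simp: convex_halfspace_le)

lemma polyt_closed: "closed (polyt N v z)"
  unfolding polyt_eq_INT_halfspaces by (intro closed_INT) (auto simp: closed_halfspace_le)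

lemma mem_scaleR_image_iff:
  fixes x :: "'a::real_vector"
  assumes "r \<noteq> 0"
  shows "x \<in> (*\<^sub>R) r ` K \<longleftrightarrow> (1/r) *\<^sub>R x \<in> K"
proof
  assume "(1/r) *\<^sub>R x \<in> K"
  moreover have "x = r *\<^sub>R ((1/r) *\<^sub>R x)" using assms by simp
  ultimately show "x \<in> (*\<^sub>R) r ` K" by (rule rev_image_eqI)
qed (use assms in auto)

lemma polyt_scaleR:
  assumes "r > 0"
  shows "polyt N v (\<lambda>i. r * z i) = (*\<^sub>R) r ` polyt N v z"
  using assms by (auto simp: mem_scaleR_image_iff polyt_def field_simps)

lemma cball_subset_polyt:
  assumes "\<forall>i<N. norm (v i) = 1"
  shows "cball 0 r \<subseteq> polyt N v (\<lambda>_. r)"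
proof
  fix x :: 'a assume "x \<in> cball 0 r"
  then have "x \<bullet> v i \<le> r" if "i < N" for i
    using norm_cauchy_schwarz[of x "v i"] assms that by auto
  then show "x \<in> polyt N v (\<lambda>_. r)" by (auto simp: polyt_def)
qed

lemma polyt_subset_cball:
  assumes "half_net N v" and "\<forall>i<N. z i \<le> r"
  shows "polyt N v z \<subseteq> cball 0 (2 * r)"
proof
  fix x :: 'a assume x: "x \<in> polyt N v z"
  show "x \<in> cball 0 (2 * r)"
  proof (cases "x = 0")
    case True
    obtain b :: 'a where "b \<in> sphere 0 1" using SOME_Basis norm_Basis by fastforce
    then obtain i where "i < N" using assms(1) by (auto simp: half_net_def)
    then show ?thesis using True x assms(2) by (force simp: polyt_def)
  next
    case False
    define u where "u = (1 / norm x) *\<^sub>R x"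
    have "u \<in> sphere 0 1" using False by (simp add: u_def)
    then obtain i where i: "i < N" "u \<bullet> v i > 1/2" using assms(1) unfolding half_net_def by blast
    have "norm x * (u \<bullet> v i) = x \<bullet> v i" using False by (simp add: u_def)
    also have "\<dots> \<le> r" using x i assms(2) by (force simp: polyt_def)
    finally show ?thesis using i mult_left_mono[of "1/2" "u \<bullet> v i" "norm x"] by simp
  qed
qed

lemma compact_polyt:
  assumes "half_net N v"
  shows "compact (polyt N v z)"
proof -
  have "\<forall>i<N. z i \<le> Max (z ` {..<N})" by simp
  then show ?thesis using polyt_subset_cball[OF assms] polyt_closed
    by (metis bounded_cball bounded_subset compact_eq_bounded_closed)
qed

section \<open>Radial function and chord integral\<close>

lemma
  fixes K :: "'a::euclidean_space set"
  assumes K: "compact K" "convex K" and z: "z \<in> K" and u: "u \<noteq> 0"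
  shows radial_nonneg: "0 \<le> radial K z u"
    and radial_in: "z + radial K z u *\<^sub>R u \<in> K"
    and le_radial: "\<And>t. 0 \<le> t \<Longrightarrow> z + t *\<^sub>R u \<in> K \<Longrightarrow> t \<le> radial K z u"
proof -
  define S where "S = {t. t \<ge> 0 \<and> z + t *\<^sub>R u \<in> K}"
  obtain B where B: "\<And>x. x \<in> K \<Longrightarrow> norm x \<le> B"
    using compact_imp_bounded[OF K(1)] bounded_iff by blast
  have "t \<le> 2 * B / norm u" if "t \<in> S" for t
  proof -
    have "t * norm u = norm ((z + t *\<^sub>R u) - z)" using that by (simp add: S_def)
    also have "\<dots> \<le> norm (z + t *\<^sub>R u) + norm z" by (rule norm_triangle_ineq4)
    also have "\<dots> \<le> 2 * B" using B[OF z] B[of "z + t *\<^sub>R u"] that by (auto simp: S_def)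
    finally show ?thesis using u by (simp add: field_simps)
  qed
  then have bdd: "bdd_above S" by (rule bdd_aboveI)
  have "S = {t. 0 \<le> t} \<inter> (\<lambda>t. z + t *\<^sub>R u) -` K" by (auto simp: S_def)
  moreover have "closed ((\<lambda>t. z + t *\<^sub>R u) -` K)"
    by (rule continuous_closed_vimage) (auto intro!: continuous_intros compact_imp_closed K)
  ultimately have "closed S" by (simp add: closed_Int closed_Collect_le)
  moreover have "S \<noteq> {}" using z by (auto simp: S_def intro!: exI[of _ 0])
  ultimately have "Sup S \<in> S" using bdd closed_contains_Sup by blast
  then show "0 \<le> radial K z u" "z + radial K z u *\<^sub>R u \<in> K" by (auto simp: radial_def S_def)
  show "\<And>t. 0 \<le> t \<Longrightarrow> z + t *\<^sub>R u \<in> K \<Longrightarrow> t \<le> radial K z u"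
    unfolding radial_def S_def[symmetric] by (rule cSup_upper[OF _ bdd]) (auto simp: S_def)
qed

lemma le_radial_iff:
  fixes K :: "'a::euclidean_space set"
  assumes K: "compact K" "convex K" and z: "z \<in> K" and u: "u \<noteq> 0" and a: "0 \<le> a"
  shows "a \<le> radial K z u \<longleftrightarrow> z + a *\<^sub>R u \<in> K"
proof
  assume "z + a *\<^sub>R u \<in> K" then show "a \<le> radial K z u" using le_radial[OF K z u] a by blast
next
  assume le: "a \<le> radial K z u"
  define r where "r = radial K z u"
  have r: "0 \<le> r" "z + r *\<^sub>R u \<in> K" using radial_nonneg[OF K z u] radial_in[OF K z u] by (auto simp: r_def)
  show "z + a *\<^sub>R u \<in> K"
  proof (cases "r = 0")
    case True then show ?thesis using z le a by (simp add: r_def)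
  next
    case False
    then have "z + a *\<^sub>R u = (1 - a/r) *\<^sub>R z + (a/r) *\<^sub>R (z + r *\<^sub>R u)"
      by (simp add: algebra_simps)
    also have "\<dots> \<in> K"
      using K(2) z r a le False unfolding r_def[symmetric] by (intro convexD_alt) (auto simp: field_simps)
    finally show ?thesis .
  qed
qed

lemma radial_scaleR:
  fixes K :: "'a::euclidean_space set"
  assumes K: "compact K" "convex K" and r: "r > 0" and z: "z \<in> K" and u: "u \<noteq> 0"
  shows "radial ((*\<^sub>R) r ` K) (r *\<^sub>R z) u = r * radial K z u"
proof -
  let ?K = "(*\<^sub>R) r ` K"
  have K': "compact ?K" "convex ?K" using K by (auto intro: compact_scaling convex_scaling)
  have z': "r *\<^sub>R z \<in> ?K" using z by auto
  have "a \<le> radial ?K (r *\<^sub>R z) u \<longleftrightarrow> a \<le> r * radial K z u" if a: "0 \<le> a" for a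
  proof -
    have "a \<le> radial ?K (r *\<^sub>R z) u \<longleftrightarrow> r *\<^sub>R z + a *\<^sub>R u \<in> ?K"
      by (rule le_radial_iff[OF K' z' u a])
    also have "\<dots> \<longleftrightarrow> z + (a / r) *\<^sub>R u \<in> K"
      using r by (simp add: mem_scaleR_image_iff algebra_simps)
    also have "\<dots> \<longleftrightarrow> a / r \<le> radial K z u"
      using r a by (intro le_radial_iff[OF K z u, symmetric]) simp
    finally show ?thesis using r by (simp add: divide_le_eq mult.commute)
  qed
  then show ?thesis
    using radial_nonneg[OF K' z' u] radial_nonneg[OF K z u] r
    by (metis mult_nonneg_nonneg order.refl order.antisym less_imp_le)
qed

lemma radial_le:
  fixes K :: "'a::euclidean_space set"
  assumes K: "compact K" "convex K" and z: "z \<in> K" and u: "norm u = 1" and sub: "K \<subseteq> cball 0 R"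
  shows "radial K z u \<le> 2 * R"
proof -
  define t where "t = radial K z u"
  have u0: "u \<noteq> 0" using u by auto
  have t: "0 \<le> t" "z + t *\<^sub>R u \<in> K"
    using radial_nonneg[OF K z u0] radial_in[OF K z u0] by (auto simp: t_def)
  have "t = norm ((z + t *\<^sub>R u) - z)" using t u by simp
  also have "\<dots> \<le> norm (z + t *\<^sub>R u) + norm z" by (rule norm_triangle_ineq4)
  also have "\<dots> \<le> 2 * R"
    using sub t(2) z mem_cball_0[of _ R] by (smt (verit) subsetD)
  finally show ?thesis by (simp add: t_def)
qed

(* The radial function as a function of base point and direction, made total (value 0 off
   K \<times> -{0}) so that it is jointly Borel measurable. *)
definition radial_total :: "'a::euclidean_space set \<Rightarrow> 'a \<times> 'a \<Rightarrow> real" where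
  "radial_total K w = (if fst w \<in> K \<and> snd w \<noteq> 0 then radial K (fst w) (snd w) else 0)"

definition dual_integrand :: "real \<Rightarrow> 'a::euclidean_space set \<Rightarrow> 'a \<Rightarrow> 'a \<Rightarrow> ennreal" where
  "dual_integrand s K z x =
     (if radial_total K (z, (1 / norm x) *\<^sub>R x) > 0
      then ennreal (radial_total K (z, (1 / norm x) *\<^sub>R x) powr s) else 0) * indicator (ball 0 1) x"

lemma radial_total_nonneg: "compact K \<Longrightarrow> convex K \<Longrightarrow> 0 \<le> radial_total K w"
  using radial_nonneg[of K "fst w" "snd w"] by (auto simp: radial_total_def)

lemma borel_measurable_radial_total:
  fixes K :: "'a::euclidean_space set"
  assumes K: "compact K" "convex K"
  shows "radial_total K \<in> borel_measurable borel"
  unfolding borel_measurable_iff_ge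
proof
  fix a :: real
  show "{w \<in> space borel. a \<le> radial_total K w} \<in> sets borel"
  proof (cases "a \<le> 0")
    case True
    then have "{w \<in> space borel. a \<le> radial_total K w} = UNIV"
      using radial_total_nonneg[OF K] by (auto intro: order_trans)
    then show ?thesis by simp
  next
    case False
    have "{w \<in> space borel. a \<le> radial_total K w} =
      (fst -` K) \<inter> - (snd -` {0}) \<inter> ((\<lambda>w. fst w + a *\<^sub>R snd w) -` K)"
      using False le_radial_iff[OF K, of _ _ a] by (auto simp: radial_total_def)
    moreover have "closed ((\<lambda>w::'a \<times> 'a. fst w + a *\<^sub>R snd w) -` K)"
      by (rule continuous_closed_vimage) (auto intro!: continuous_intros compact_imp_closed K)
    moreover have "closed (fst -` K :: ('a \<times> 'a) set)"
      by (rule closed_vimage_fst) (simp add: compact_imp_closed K)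
    moreover have "open (- (snd -` {0}) :: ('a \<times> 'a) set)" by (auto intro: closed_vimage_snd)
    ultimately show ?thesis by (simp add: sets.Int borel_closed borel_open)
  qed
qed

lemma borel_measurable_dual_integrand:
  fixes K :: "'a::euclidean_space set"
  assumes K: "compact K" "convex K"
  shows "case_prod (dual_integrand s K) \<in> borel_measurable (lborel \<Otimes>\<^sub>M lborel)"
proof -
  have "radial_total K \<in> borel_measurable (borel \<Otimes>\<^sub>M borel)"
    using borel_measurable_radial_total[OF K] by (simp add: borel_prod)
  then have [measurable]: "(\<lambda>w::'a \<times> 'a. radial_total K (fst w, (1 / norm (snd w)) *\<^sub>R snd w))
      \<in> borel_measurable (lborel \<Otimes>\<^sub>M lborel)"
    by (rule measurable_compose[rotated]) measurable
  have [measurable]: "ball (0::'a) 1 \<in> sets borel" by simp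
  show ?thesis unfolding dual_integrand_def case_prod_beta by measurable
qed

lemma dual_qvol_eq_nn_integral:
  fixes K :: "'a::euclidean_space set"
  assumes z: "z \<in> K"
  shows "dual_qvol s K z = (\<integral>\<^sup>+x. dual_integrand s K z x \<partial>lborel)"
proof -
  have "AE x in lborel. (if radial K z ((1 / norm x) *\<^sub>R x) > 0
      then ennreal (radial K z ((1 / norm x) *\<^sub>R x) powr s) else 0) * indicator (ball 0 1) x
      = dual_integrand s K z x"
    using AE_lborel_singleton[of 0] by eventually_elim (simp add: dual_integrand_def radial_total_def z)
  moreover have "ennreal (1 / real DIM('a)) * ennreal (real DIM('a)) = 1"
    by (simp add: ennreal_mult[symmetric])
  ultimately show ?thesis
    unfolding dual_qvol_def sphere_int_def by (simp add: nn_integral_cong_AE mult.assoc[symmetric])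
qed

lemma borel_measurable_chord_integrand:
  fixes K :: "'a::euclidean_space set"
  assumes K: "compact K" "convex K"
  shows "(\<lambda>z. dual_qvol s K z * indicator K z) \<in> borel_measurable lborel"
proof -
  have "(\<lambda>z. dual_qvol s K z * indicator K z) =
      (\<lambda>z. (\<integral>\<^sup>+x. dual_integrand s K z x \<partial>lborel) * indicator K z)"
    by (rule ext) (auto simp: dual_qvol_eq_nn_integral indicator_def)
  moreover note [measurable] = borel_measurable_dual_integrand[OF K]
  moreover have [measurable]: "K \<in> sets borel" using K by (simp add: compact_imp_closed borel_closed)
  ultimately show ?thesis by simp
qed

lemma dual_qvol_scaleR:
  fixes K :: "'a::euclidean_space set"
  assumes K: "compact K" "convex K" and r: "r > 0" and z: "z \<in> K"
  shows "dual_qvol s ((*\<^sub>R) r ` K) (r *\<^sub>R z) = ennreal (r powr s) * dual_qvol s K z"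
proof -
  have z': "r *\<^sub>R z \<in> (*\<^sub>R) r ` K" using z by auto
  have scale: "dual_integrand s ((*\<^sub>R) r ` K) (r *\<^sub>R z) x = ennreal (r powr s) * dual_integrand s K z x" for x
  proof (cases "x = 0")
    case False
    let ?u = "(1 / norm x) *\<^sub>R x"
    have "radial_total ((*\<^sub>R) r ` K) (r *\<^sub>R z, ?u) = r * radial_total K (z, ?u)"
      using radial_scaleR[OF K r z] z z' False by (simp add: radial_total_def)
    then show ?thesis using r radial_total_nonneg[OF K, of "(z, ?u)"] unfolding dual_integrand_def
      by (auto simp: powr_mult ennreal_mult zero_less_mult_iff indicator_def)
  qed (simp add: dual_integrand_def radial_total_def)
  have "(\<lambda>x. dual_integrand s K z x) \<in> borel_measurable lborel"
    using measurable_Pair2[OF borel_measurable_dual_integrand[OF K], of z] by simp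
  then show ?thesis
    by (simp add: dual_qvol_eq_nn_integral z z' scale nn_integral_cmult)
qed

lemma nn_integral_lborel_scaleR:
  fixes f :: "'a::euclidean_space \<Rightarrow> ennreal"
  assumes [measurable]: "f \<in> borel_measurable borel" and c: "c \<noteq> 0"
  shows "(\<integral>\<^sup>+x. f x \<partial>lborel) = ennreal (\<bar>c\<bar> ^ DIM('a)) * (\<integral>\<^sup>+x. f (c *\<^sub>R x) \<partial>lborel)"
  by (subst lborel_affine[OF c, of 0]) (simp add: nn_integral_density nn_integral_distr nn_integral_cmult)

lemma chord_int_scaleR:
  fixes K :: "'a::euclidean_space set"
  assumes K: "compact K" "convex K" and r: "r > 0"
  shows "chord_int q ((*\<^sub>R) r ` K) = ennreal (r powr (real DIM('a) + q - 1)) * chord_int q K"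
proof -
  let ?K = "(*\<^sub>R) r ` K"
  let ?G = "\<lambda>K z. dual_qvol (q - 1) K z * indicator K z"
  have K': "compact ?K" "convex ?K" using K by (auto intro: compact_scaling convex_scaling)
  have G_scale: "?G ?K (r *\<^sub>R x) = ennreal (r powr (q - 1)) * ?G K x" for x
    using dual_qvol_scaleR[OF K r] r by (cases "x \<in> K") (auto simp: mem_scaleR_image_iff)
  have "integral\<^sup>N lborel (?G ?K)
      = ennreal (r ^ DIM('a)) * (\<integral>\<^sup>+x. ?G ?K (r *\<^sub>R x) \<partial>lborel)"
    using nn_integral_lborel_scaleR[of "?G ?K" r] borel_measurable_chord_integrand[OF K'] r by simp
  also have "\<dots> = ennreal (r ^ DIM('a)) * ennreal (r powr (q - 1)) * integral\<^sup>N lborel (?G K)"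
    using borel_measurable_chord_integrand[OF K]
    by (simp only: G_scale nn_integral_cmult mult.assoc)
  also have "ennreal (r ^ DIM('a)) * ennreal (r powr (q - 1)) = ennreal (r powr (real DIM('a) + q - 1))"
    using r by (simp add: ennreal_mult[symmetric] powr_add[symmetric] powr_realpow[symmetric] add_diff_eq)
  finally show ?thesis unfolding chord_int_def by (simp add: ac_simps)
qed

lemma emeasure_lborel_ball_eq_measure:
  "emeasure lborel (ball (0::'a::euclidean_space) r) = ennreal (measure lborel (ball (0::'a) r))"
  using emeasure_lborel_ball_finite[of "0::'a" r] by (simp add: emeasure_eq_ennreal_measure)

lemma dual_qvol_le_const:
  fixes K :: "'a::euclidean_space set"
  assumes z: "z \<in> K" and b: "0 \<le> b"
    and bound: "\<And>u. norm u = 1 \<Longrightarrow> radial K z u > 0 \<Longrightarrow> radial K z u powr s \<le> b"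
  shows "dual_qvol s K z \<le> ennreal (b * measure lborel (ball (0::'a) 1))"
proof -
  have "AE x in lborel. dual_integrand s K z x \<le> ennreal b * indicator (ball (0::'a) 1) x"
    using AE_lborel_singleton[of 0]
  proof eventually_elim
    case (elim x)
    then have "norm ((1 / norm x) *\<^sub>R x) = 1" by simp
    then show ?case
      using z b bound by (auto simp: dual_integrand_def radial_total_def indicator_def intro: ennreal_leI)
  qed
  then have "dual_qvol s K z \<le> (\<integral>\<^sup>+x. ennreal b * indicator (ball (0::'a) 1) x \<partial>lborel)"
    unfolding dual_qvol_eq_nn_integral[OF z] by (rule nn_integral_mono_AE)
  then show ?thesis
    using b by (simp add: nn_integral_cmult_indicator emeasure_lborel_ball_eq_measure ennreal_mult)
qed

lemma dual_qvol_ge_const: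
  fixes K :: "'a::euclidean_space set"
  assumes z: "z \<in> K" and a: "0 \<le> a"
    and bound: "\<And>u. norm u = 1 \<Longrightarrow> radial K z u > 0 \<and> a \<le> radial K z u powr s"
  shows "ennreal (a * measure lborel (ball (0::'a) 1)) \<le> dual_qvol s K z"
proof -
  have "AE x in lborel. ennreal a * indicator (ball (0::'a) 1) x \<le> dual_integrand s K z x"
    using AE_lborel_singleton[of 0]
    by eventually_elim (use z bound in \<open>auto simp: dual_integrand_def radial_total_def indicator_def\<close>)
  then have "(\<integral>\<^sup>+x. ennreal a * indicator (ball (0::'a) 1) x \<partial>lborel) \<le> dual_qvol s K z"
    unfolding dual_qvol_eq_nn_integral[OF z] by (rule nn_integral_mono_AE)
  then show ?thesis
    using a by (simp add: nn_integral_cmult_indicator emeasure_lborel_ball_eq_measure ennreal_mult)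
qed

lemma chord_int_lower_bound:
  assumes q: "q > 0"
  obtains L where "L > 0"
    and "\<And>K::'a::euclidean_space set. compact K \<Longrightarrow> convex K \<Longrightarrow> cball 0 1 \<subseteq> K \<Longrightarrow> K \<subseteq> cball 0 2
           \<Longrightarrow> ennreal L \<le> chord_int q K"
proof
  define a where "a = min ((1/2) powr (q - 1)) (4 powr (q - 1))"
  define \<omega> where "\<omega> = measure lborel (ball (0::'a) 1)"
  have a: "a > 0" by (simp add: a_def)
  have \<omega>: "\<omega> > 0" using content_ball_pos[of 1 "0::'a"] by (simp add: \<omega>_def)
  show "q * a * measure lborel (ball (0::'a) (1/2)) > 0"
    using q a content_ball_pos[of "1/2" "0::'a"] by simp
  fix K :: "'a set"
  assume K: "compact K" "convex K" and sub1: "cball 0 1 \<subseteq> K" and sub2: "K \<subseteq> cball 0 2"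
  have dual: "ennreal (a * \<omega>) \<le> dual_qvol (q - 1) K z" if z: "z \<in> ball 0 (1/2)" for z
  proof -
    have zK: "z \<in> K" using z sub1 by auto
    have "radial K z u > 0 \<and> a \<le> radial K z u powr (q - 1)" if u: "norm u = 1" for u
    proof -
      have "norm (z + (1/2) *\<^sub>R u) \<le> norm z + norm ((1/2) *\<^sub>R u)" by (rule norm_triangle_ineq)
      also have "\<dots> \<le> 1" using z u by simp
      finally have "z + (1/2) *\<^sub>R u \<in> K" using sub1 by auto
      moreover have "u \<noteq> 0" using u by auto
      ultimately have "1/2 \<le> radial K z u" using le_radial[OF K zK, of u "1/2"] by linarith
      moreover have "radial K z u \<le> 4" using radial_le[OF K zK u sub2] by simp
      ultimately show ?thesis unfolding a_def
        by (cases "q - 1 \<ge> 0") (auto intro: powr_mono2 powr_mono2' simp: min_le_iff_disj)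
    qed
    then show ?thesis unfolding \<omega>_def using a by (intro dual_qvol_ge_const[OF zK]) auto
  qed
  have "(\<integral>\<^sup>+z. ennreal (a * \<omega>) * indicator (ball (0::'a) (1/2)) z \<partial>lborel)
      \<le> (\<integral>\<^sup>+z. dual_qvol (q - 1) K z * indicator K z \<partial>lborel)"
    using dual sub1 by (intro nn_integral_mono) (auto simp: indicator_def subset_iff)
  then have "ennreal (q / \<omega>) * (ennreal (a * \<omega>) * ennreal (measure lborel (ball (0::'a) (1/2))))
      \<le> chord_int q K"
    unfolding chord_int_def \<omega>_def
    by (intro mult_left_mono) (simp_all add: nn_integral_cmult_indicator emeasure_lborel_ball_eq_measure)
  also have "ennreal (q / \<omega>) * (ennreal (a * \<omega>) * ennreal (measure lborel (ball (0::'a) (1/2))))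
      = ennreal (q * a * measure lborel (ball (0::'a) (1/2)))"
    using \<omega> q a by (simp add: ennreal_mult[symmetric] field_simps)
  finally show "ennreal (q * a * measure lborel (ball (0::'a) (1/2))) \<le> chord_int q K" .
qed

lemma chord_int_finite_if_ge_1:
  fixes K :: "'a::euclidean_space set"
  assumes K: "compact K" "convex K" and sub: "K \<subseteq> cball 0 2" and q: "q \<ge> 1"
  shows "chord_int q K < \<top>"
proof -
  define c where "c = 4 powr (q - 1) * measure lborel (ball (0::'a) 1)"
  have "dual_qvol (q - 1) K z \<le> ennreal c" if z: "z \<in> K" for z
    unfolding c_def using radial_le[OF K z _ sub] q
    by (intro dual_qvol_le_const[OF z]) (auto intro: powr_mono2)
  then have "(\<integral>\<^sup>+z. dual_qvol (q - 1) K z * indicator K z \<partial>lborel)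
      \<le> (\<integral>\<^sup>+z. ennreal c * indicator (cball (0::'a) 2) z \<partial>lborel)"
    using sub by (intro nn_integral_mono) (auto simp: indicator_def)
  also have "\<dots> < \<top>"
    using emeasure_bounded_finite[of "cball (0::'a) 2"] by (simp add: nn_integral_cmult_indicator ennreal_mult_less_top)
  finally show ?thesis unfolding chord_int_def by (simp add: ennreal_mult_less_top)
qed

definition dyadic_shrink :: "'a::real_vector set \<Rightarrow> nat \<Rightarrow> 'a set" where
  "dyadic_shrink K k = (*\<^sub>R) (1 - (1/2)^k) ` K"

lemma scaleR_image_subset:
  fixes K :: "'a::real_vector set"
  assumes "convex K" "0 \<in> K" "0 \<le> s" "s \<le> 1"
  shows "(*\<^sub>R) s ` K \<subseteq> K"
proof
  fix y assume "y \<in> (*\<^sub>R) s ` K"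
  then obtain w where w: "w \<in> K" "y = s *\<^sub>R w" by auto
  have "(1 - s) *\<^sub>R 0 + s *\<^sub>R w \<in> K" using assms w by (intro convexD_alt) auto
  then show "y \<in> K" using w by simp
qed

lemma measure_scaleR_image:
  fixes K :: "'a::euclidean_space set"
  assumes "compact K" "0 \<le> s"
  shows "measure lborel ((*\<^sub>R) s ` K) = s ^ DIM('a) * measure lborel K"
proof -
  have "measure lebesgue ((\<lambda>x. s *\<^sub>R x + 0) ` K) = \<bar>s\<bar> ^ DIM('a) * measure lebesgue K"
    by (rule measure_lebesgue_affine)
  moreover have "(*\<^sub>R) s ` K \<in> sets borel" "K \<in> sets borel"
    using assms by (auto intro: borel_closed compact_imp_closed compact_scaling)
  ultimately show ?thesis using assms by simp
qed

lemma emeasure_diff_scaleR_image_le: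
  fixes K :: "'a::euclidean_space set"
  assumes K: "compact K" "convex K" "0 \<in> K" and s: "0 \<le> s" "s \<le> 1"
  shows "emeasure lborel (K - (*\<^sub>R) s ` K) \<le> ennreal (real DIM('a) * (1 - s) * measure lborel K)"
proof -
  have sub: "(*\<^sub>R) s ` K \<subseteq> K" using scaleR_image_subset[OF K(2,3) s] .
  have borel: "K \<in> sets lborel" "(*\<^sub>R) s ` K \<in> sets lborel"
    using K by (auto intro: borel_closed compact_imp_closed compact_scaling)
  have fin: "emeasure lborel K \<noteq> \<top>"
    using emeasure_bounded_finite[of K] compact_imp_bounded[OF K(1)] by simp
  have "1 + real DIM('a) * (- (1 - s)) \<le> (1 + - (1 - s)) ^ DIM('a)"
    using s by (intro Bernoulli_inequality) simp
  then have "(1 - real DIM('a) * (1 - s)) * measure lborel K \<le> s ^ DIM('a) * measure lborel K"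
    by (intro mult_right_mono) (simp_all add: algebra_simps)
  then have "measure lborel K - s ^ DIM('a) * measure lborel K
      \<le> real DIM('a) * (1 - s) * measure lborel K"
    by (simp add: algebra_simps)
  moreover have "emeasure lborel (K - (*\<^sub>R) s ` K) = ennreal (measure lborel (K - (*\<^sub>R) s ` K))"
    using fin borel sub by (intro emeasure_eq_ennreal_measure)
      (metis Diff_subset emeasure_mono infinity_ennreal_def top.extremum_uniqueI)
  ultimately show ?thesis
    using measure_Diff[OF _ borel(1,2) sub] fin measure_scaleR_image[OF K(1) s(1)]
    by (simp add: ennreal_leI)
qed

lemma emeasure_diff_Union_dyadic_shrink:
  fixes K :: "'a::euclidean_space set"
  assumes K: "compact K" "convex K" "0 \<in> K"
  shows "emeasure lborel (K - (\<Union>k. dyadic_shrink K k)) = 0"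
proof -
  define c where "c = real DIM('a) * measure lborel K"
  have "emeasure lborel (K - (\<Union>k. dyadic_shrink K k)) \<le> ennreal (c * (1/2)^j)" for j
  proof -
    have "K \<in> sets borel" "dyadic_shrink K j \<in> sets borel"
      using K(1) by (auto intro: borel_closed compact_imp_closed compact_scaling simp: dyadic_shrink_def)
    then have "emeasure lborel (K - (\<Union>k. dyadic_shrink K k)) \<le> emeasure lborel (K - dyadic_shrink K j)"
      by (intro emeasure_mono) auto
    also have "\<dots> \<le> ennreal (c * (1/2)^j)"
      using emeasure_diff_scaleR_image_le[OF K, of "1 - (1/2)^j"]
      by (simp add: dyadic_shrink_def c_def power_le_one mult_ac)
    finally show ?thesis .
  qed
  moreover have "(\<lambda>j. ennreal (c * (1/2)^j)) \<longlonglongrightarrow> ennreal (c * 0)"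
    by (intro tendsto_ennrealI tendsto_intros) simp
  ultimately have "emeasure lborel (K - (\<Union>k. dyadic_shrink K k)) \<le> ennreal (c * 0)"
    by (intro LIMSEQ_le_const) auto
  then show ?thesis by simp
qed

lemma half_power_powr: "((1/2::real) ^ n) powr (q - 1) = (2 powr (1 - q)) ^ n"
  by (simp add: powr_realpow[symmetric] powr_powr powr_divide powr_minus_divide[symmetric] mult.commute
      flip: powr_realpow) (simp add: algebra_simps)

lemma dyadic_shrink_subset: "convex K \<Longrightarrow> 0 \<in> K \<Longrightarrow> dyadic_shrink K k \<subseteq> K"
  unfolding dyadic_shrink_def by (rule scaleR_image_subset) (simp_all add: power_le_one)

lemma dual_qvol_le_on_scaleR_image:
  fixes K :: "'a::euclidean_space set"
  assumes K: "compact K" "convex K" and sub: "cball 0 1 \<subseteq> K" and q: "q \<le> 1"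
    and s: "0 \<le> s" "s < 1" and z: "z \<in> (*\<^sub>R) s ` K"
  shows "dual_qvol (q - 1) K z \<le> ennreal ((1 - s) powr (q - 1) * measure lborel (ball (0::'a) 1))"
proof -
  obtain w where w: "w \<in> K" "z = s *\<^sub>R w" using z by auto
  have zK: "z \<in> K" using scaleR_image_subset[OF K(2) _ s(1)] sub z s by force
  have "radial K z u powr (q - 1) \<le> (1 - s) powr (q - 1)" if u: "norm u = 1" for u
  proof -
    have "u \<in> K" using u sub by auto
    then have "(1 - s) *\<^sub>R u + s *\<^sub>R w \<in> K" using K(2) w s by (intro convexD_alt) auto
    then have "z + (1 - s) *\<^sub>R u \<in> K" using w by (simp add: add.commute)
    moreover have "u \<noteq> 0" using u by auto
    ultimately have "1 - s \<le> radial K z u" using le_radial[OF K zK, of u "1 - s"] s by auto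
    then show ?thesis using s q by (intro powr_mono2') auto
  qed
  then show ?thesis by (intro dual_qvol_le_const[OF zK]) auto
qed

lemma dual_qvol_le_shells:
  fixes K :: "'a::euclidean_space set"
  assumes K: "compact K" "convex K" and sub: "cball 0 1 \<subseteq> K" and q: "q \<le> 1"
    and z: "z \<in> dyadic_shrink K k" "z \<noteq> 0"
  shows "dual_qvol (q - 1) K z \<le> (\<Sum>j. ennreal ((2 powr (1 - q)) ^ Suc j * measure lborel (ball (0::'a) 1))
           * indicator (dyadic_shrink K (Suc j) - dyadic_shrink K j) z)"
proof -
  define i where "i = (LEAST i. z \<in> dyadic_shrink K i)"
  have zi: "z \<in> dyadic_shrink K i" unfolding i_def using z(1) by (rule LeastI)
  then have "i \<noteq> 0" using z(2) by (cases "i = 0") (auto simp: dyadic_shrink_def)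
  then obtain j where j: "i = Suc j" using not0_implies_Suc by blast
  then have "z \<notin> dyadic_shrink K j" using not_less_Least[of j "\<lambda>i. z \<in> dyadic_shrink K i"] by (simp add: i_def)
  then have "z \<in> dyadic_shrink K (Suc j) - dyadic_shrink K j" using zi j by simp
  moreover have "dual_qvol (q - 1) K z \<le> ennreal ((2 powr (1 - q)) ^ Suc j * measure lborel (ball (0::'a) 1))"
  proof -
    have zs: "z \<in> (*\<^sub>R) (1 - (1/2)^Suc j) ` K" using zi j by (simp only: dyadic_shrink_def)
    have s: "0 \<le> 1 - (1/2::real)^Suc j" "1 - (1/2::real)^Suc j < 1"
      by (simp_all only: diff_ge_0_iff_ge power_le_one_iff) simp_all
    have "1 - (1 - (1/2)^Suc j) = (1/2::real)^Suc j" by simp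
    then show ?thesis
      using dual_qvol_le_on_scaleR_image[OF K sub q s zs] by (simp only: half_power_powr)
  qed
  ultimately have "dual_qvol (q - 1) K z \<le> (\<Sum>i\<in>{j}. ennreal ((2 powr (1 - q)) ^ Suc i
      * measure lborel (ball (0::'a) 1)) * indicator (dyadic_shrink K (Suc i) - dyadic_shrink K i) z)"
    by simp
  also have "\<dots> \<le> (\<Sum>i. ennreal ((2 powr (1 - q)) ^ Suc i * measure lborel (ball (0::'a) 1))
      * indicator (dyadic_shrink K (Suc i) - dyadic_shrink K i) z)"
    by (rule sum_le_suminf) auto
  finally show ?thesis .
qed

lemma emeasure_dyadic_shell_le:
  fixes K :: "'a::euclidean_space set"
  assumes K: "compact K" "convex K" "0 \<in> K"
  shows "emeasure lborel (dyadic_shrink K (Suc j) - dyadic_shrink K j)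
           \<le> ennreal (real DIM('a) * (1/2)^j * measure lborel K)"
proof -
  have "K \<in> sets borel" "dyadic_shrink K j \<in> sets borel"
    using K(1) by (auto intro: borel_closed compact_imp_closed compact_scaling simp: dyadic_shrink_def)
  then have "emeasure lborel (dyadic_shrink K (Suc j) - dyadic_shrink K j)
      \<le> emeasure lborel (K - dyadic_shrink K j)"
    using dyadic_shrink_subset[OF K(2,3), of "Suc j"] by (intro emeasure_mono) auto
  also have "\<dots> \<le> ennreal (real DIM('a) * (1/2)^j * measure lborel K)"
    using emeasure_diff_scaleR_image_le[OF K, of "1 - (1/2)^j"]
    by (simp add: dyadic_shrink_def power_le_one)
  finally show ?thesis .
qed

lemma AE_chord_integrand_le_shells:
  fixes K :: "'a::euclidean_space set"
  assumes K: "compact K" "convex K" and sub: "cball 0 1 \<subseteq> K" and q: "q \<le> 1"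
  shows "AE z in lborel. dual_qvol (q - 1) K z * indicator K z
    \<le> (\<Sum>j. ennreal ((2 powr (1 - q)) ^ Suc j * measure lborel (ball (0::'a) 1))
          * indicator (dyadic_shrink K (Suc j) - dyadic_shrink K j) z)"
proof -
  have "0 \<in> K" using sub by auto
  have "K \<in> sets borel" "\<And>k. dyadic_shrink K k \<in> sets borel"
    using K(1) by (auto intro: borel_closed compact_imp_closed compact_scaling simp: dyadic_shrink_def)
  then have "K - (\<Union>k. dyadic_shrink K k) \<in> null_sets lborel"
    using emeasure_diff_Union_dyadic_shrink[OF K \<open>0 \<in> K\<close>] by (auto intro: null_setsI)
  then have "AE z in lborel. z \<notin> K - (\<Union>k. dyadic_shrink K k) \<and> z \<noteq> 0"
    using AE_lborel_singleton[of 0] by (auto dest: AE_not_in elim: AE_mp)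
  then show ?thesis
  proof eventually_elim
    case (elim z)
    show ?case
    proof (cases "z \<in> K")
      case True
      then obtain k where "z \<in> dyadic_shrink K k" using elim by blast
      then show ?thesis using dual_qvol_le_shells[OF K sub q] True elim by simp
    qed simp
  qed
qed

(* On the shell between the dyadic shrinkings j and j + 1 the radial function is at least
   2^-(j+1), so the integrand is at most (2^(1-q))^(j+1), while the shell has volume O(2^-j);
   the series converges because q > 0. *)
lemma chord_int_finite_if_lt_1:
  fixes K :: "'a::euclidean_space set"
  assumes K: "compact K" "convex K" and sub: "cball 0 1 \<subseteq> K" and q: "0 < q" "q < 1"
  shows "chord_int q K < \<top>"
proof -
  define t where "t = 2 powr (1 - q)"
  define \<omega> where "\<omega> = measure lborel (ball (0::'a) 1)"
  define c where "c = t * \<omega> * real DIM('a) * measure lborel K"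
  define A where "A j = dyadic_shrink K (Suc j) - dyadic_shrink K j" for j
  have t: "0 < t" "t / 2 < 1"
    using q by (simp_all add: t_def powr_diff powr_less_cancel_iff[of 2 "1 - q" 1, simplified])
  have "0 \<in> K" using sub by auto
  have [measurable]: "A j \<in> sets borel" for j
    using K(1) by (auto intro: borel_closed compact_imp_closed compact_scaling simp: A_def dyadic_shrink_def)
  have "(\<integral>\<^sup>+z. dual_qvol (q - 1) K z * indicator K z \<partial>lborel)
      \<le> (\<integral>\<^sup>+z. (\<Sum>j. ennreal (t ^ Suc j * \<omega>) * indicator (A j) z) \<partial>lborel)"
    using AE_chord_integrand_le_shells[OF K sub] q
    unfolding t_def \<omega>_def A_def by (intro nn_integral_mono_AE) simp
  also have "\<dots> = (\<Sum>j. ennreal (t ^ Suc j * \<omega>) * emeasure lborel (A j))"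
    by (simp add: nn_integral_suminf nn_integral_cmult_indicator)
  also have "\<dots> \<le> (\<Sum>j. ennreal (t ^ Suc j * \<omega>) * ennreal (real DIM('a) * (1/2)^j * measure lborel K))"
    unfolding A_def using emeasure_dyadic_shell_le[OF K \<open>0 \<in> K\<close>]
    by (intro suminf_le mult_left_mono) auto
  also have "\<dots> = (\<Sum>j. ennreal (c * (t / 2) ^ j))"
    using t by (subst ennreal_mult[symmetric]) (auto simp: \<omega>_def c_def power_divide field_simps)
  also have "\<dots> < \<top>"
  proof -
    have "summable (\<lambda>j. c * (t / 2) ^ j)" using t by (intro summable_mult summable_geometric) simp
    moreover have "0 \<le> c * (t / 2) ^ j" for j using t by (simp add: c_def \<omega>_def)
    ultimately show ?thesis using ennreal_suminf_neq_top less_top by blast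
  qed
  finally show ?thesis unfolding chord_int_def by (simp add: ennreal_mult_less_top)
qed

lemma chord_int_finite:
  fixes K :: "'a::euclidean_space set"
  assumes "compact K" "convex K" "cball 0 1 \<subseteq> K" "K \<subseteq> cball 0 2" "0 < q"
  shows "chord_int q K < \<top>"
proof (cases "q < 1")
  case True
  then show ?thesis using assms by (intro chord_int_finite_if_lt_1) auto
next
  case False
  then show ?thesis using assms by (intro chord_int_finite_if_ge_1) auto
qed

section \<open>The maximiser xi_max\<close>

lemma Phi_disc_neq_MInf:
  "p \<noteq> 0 \<or> (\<forall>i<N. \<xi> \<bullet> v i < z i) \<Longrightarrow> Phi_disc p N \<alpha> v z \<xi> \<noteq> -\<infinity>"
  by (auto simp: Phi_disc_def)

(* For p = 0, Phi_disc is -\<infinity> on part of the boundary; one maximises instead the continuous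
   product of the gaps raised to the weights, whose logarithm it is. *)
lemma Phi_disc_attains_max:
  fixes v :: "nat \<Rightarrow> 'a::euclidean_space"
  assumes net: "half_net N v" and \<alpha>: "\<forall>i<N. \<alpha> i > 0" and z: "\<forall>i<N. z i > 0" and p: "0 \<le> p"
  shows "\<exists>\<xi>\<in>polyt N v z. \<forall>\<eta>\<in>polyt N v z. Phi_disc p N \<alpha> v z \<eta> \<le> Phi_disc p N \<alpha> v z \<xi>"
proof -
  let ?P = "polyt N v z"
  have P0: "0 \<in> ?P" using z by (auto simp: polyt_def less_imp_le)
  have gap: "0 \<le> z i - \<xi> \<bullet> v i" if "\<xi> \<in> ?P" "i < N" for \<xi> i using that by (simp add: polyt_def)
  show ?thesis
  proof (cases "p = 0")
    case False
    define g where "g \<xi> = (\<Sum>i<N. (z i - \<xi> \<bullet> v i) powr p * \<alpha> i)" for \<xi>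
    have "continuous_on ?P g" unfolding g_def using False p gap
      by (intro continuous_on_sum continuous_on_mult continuous_on_const continuous_on_powr')
         (auto intro!: continuous_intros)
    then obtain \<xi> where "\<xi> \<in> ?P" "\<forall>\<eta>\<in>?P. g \<eta> \<le> g \<xi>"
      using continuous_attains_sup[OF compact_polyt[OF net]] P0 by blast
    then show ?thesis using False by (auto simp: Phi_disc_def g_def)
  next
    case True
    define g where "g \<xi> = (\<Prod>i<N. (z i - \<xi> \<bullet> v i) powr \<alpha> i)" for \<xi>
    have "continuous_on ?P g" unfolding g_def using \<alpha> gap
      by (intro continuous_on_prod continuous_on_powr') (auto intro!: continuous_intros)
    then obtain \<xi> where \<xi>: "\<xi> \<in> ?P" "\<forall>\<eta>\<in>?P. g \<eta> \<le> g \<xi>"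
      using continuous_attains_sup[OF compact_polyt[OF net]] P0 by blast
    have "0 < g 0" using z by (auto simp: g_def intro!: prod_pos)
    also have "g 0 \<le> g \<xi>" using \<xi> P0 by blast
    finally have "g \<xi> \<noteq> 0" by simp
    then have "\<forall>i<N. z i - \<xi> \<bullet> v i \<noteq> 0" unfolding g_def by (metis lessThan_iff powr_0 prod_zero finite_lessThan)
    then have "\<forall>i<N. 0 < z i - \<xi> \<bullet> v i" using gap[OF \<xi>(1)] by (auto simp: order.order_iff_strict)
    moreover have "Phi_disc p N \<alpha> v z \<eta> = ereal (ln (g \<eta>))" if "\<forall>i<N. 0 < z i - \<eta> \<bullet> v i" for \<eta>
      using that True unfolding Phi_disc_def g_def by (subst ln_prod) (auto simp: ln_powr)
    moreover have "\<forall>i<N. 0 < z i - \<eta> \<bullet> v i \<Longrightarrow> 0 < g \<eta>" for \<eta>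
      by (auto simp: g_def intro!: prod_pos)
    ultimately have "\<forall>\<eta>\<in>?P. Phi_disc p N \<alpha> v z \<eta> \<le> Phi_disc p N \<alpha> v z \<xi>"
      using \<xi>(2) True by (auto simp: Phi_disc_def)
    then show ?thesis using \<xi>(1) by blast
  qed
qed

lemma Phi_disc_less_midpoint:
  fixes v :: "nat \<Rightarrow> 'a::euclidean_space"
  assumes net: "half_net N v" and \<alpha>: "\<forall>i<N. \<alpha> i > 0" and p: "0 \<le> p" "p < 1"
    and \<xi>: "\<xi>1 \<in> polyt N v z" "\<xi>2 \<in> polyt N v z" "\<xi>1 \<noteq> \<xi>2"
    and eq: "Phi_disc p N \<alpha> v z \<xi>1 = Phi_disc p N \<alpha> v z \<xi>2"
    and fin: "Phi_disc p N \<alpha> v z \<xi>1 \<noteq> -\<infinity>"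
  shows "Phi_disc p N \<alpha> v z \<xi>1 < Phi_disc p N \<alpha> v z (midpoint \<xi>1 \<xi>2)"
proof -
  define a where "a i = z i - \<xi>1 \<bullet> v i" for i
  define b where "b i = z i - \<xi>2 \<bullet> v i" for i
  have mid: "z i - midpoint \<xi>1 \<xi>2 \<bullet> v i = (a i + b i) / 2" for i
    by (simp add: midpoint_def a_def b_def inner_add_left field_simps)
  have ab: "0 \<le> a i" "0 \<le> b i" if "i < N" for i using \<xi> that by (auto simp: a_def b_def polyt_def)
  obtain i0 where i0: "i0 < N" "a i0 \<noteq> b i0"
  proof -
    define u where "u = (1 / norm (\<xi>1 - \<xi>2)) *\<^sub>R (\<xi>1 - \<xi>2)"
    have "u \<in> sphere 0 1" using \<xi>(3) by (simp add: u_def)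
    then obtain i where i: "i < N" "u \<bullet> v i > 1/2" using net unfolding half_net_def by blast
    then have "(\<xi>1 - \<xi>2) \<bullet> v i \<noteq> 0" by (auto simp: u_def)
    then show ?thesis using i that by (auto simp: a_def b_def inner_diff_left)
  qed
  show ?thesis
  proof (cases "p = 0")
    case False
    have "(\<Sum>i<N. \<alpha> i * a i powr p) + (\<Sum>i<N. \<alpha> i * b i powr p)
        < 2 * (\<Sum>i<N. \<alpha> i * ((a i + b i) / 2) powr p)"
      using i0 ab \<alpha> p False by (intro sum_midpoint_strict[where S = "{0..}"] powr_midpoint_strict) auto
    then show ?thesis using eq False by (simp add: Phi_disc_def mid a_def b_def mult.commute)
  next
    case True
    have pos: "\<forall>i<N. 0 < a i" "\<forall>i<N. 0 < b i"
      using fin eq True by (auto simp: Phi_disc_def a_def b_def split: if_splits)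
    have "(\<Sum>i<N. \<alpha> i * ln (a i)) + (\<Sum>i<N. \<alpha> i * ln (b i))
        < 2 * (\<Sum>i<N. \<alpha> i * ln ((a i + b i) / 2))"
      using i0 pos \<alpha> by (intro sum_midpoint_strict[where S = "{0<..}"] ln_midpoint_strict) auto
    moreover have "\<forall>i<N. 0 < (a i + b i) / 2" using pos by (simp add: add_pos_pos)
    ultimately show ?thesis
      using eq True pos by (simp add: Phi_disc_def mid a_def[symmetric] b_def[symmetric])
  qed
qed

lemma xi_max_maximises:
  fixes v :: "nat \<Rightarrow> 'a::euclidean_space"
  assumes net: "half_net N v" and \<alpha>: "\<forall>i<N. \<alpha> i > 0" and z: "\<forall>i<N. z i > 0"
    and p: "0 \<le> p" "p < 1"
  shows "xi_max p N \<alpha> v z \<in> polyt N v z"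
    and "\<forall>\<eta>\<in>polyt N v z. Phi_disc p N \<alpha> v z \<eta> \<le> Phi_disc p N \<alpha> v z (xi_max p N \<alpha> v z)"
proof -
  let ?P = "polyt N v z" and ?F = "Phi_disc p N \<alpha> v z"
  define Q where "Q \<xi> \<longleftrightarrow> \<xi> \<in> ?P \<and> (\<forall>\<eta>\<in>?P. ?F \<eta> \<le> ?F \<xi>)" for \<xi>
  have "\<xi>1 = \<xi>2" if Q: "Q \<xi>1" "Q \<xi>2" for \<xi>1 \<xi>2
  proof (rule ccontr)
    assume ne: "\<xi>1 \<noteq> \<xi>2"
    have P: "\<xi>1 \<in> ?P" "\<xi>2 \<in> ?P" "0 \<in> ?P" using Q z by (auto simp: Q_def polyt_def less_imp_le)
    have eq: "?F \<xi>1 = ?F \<xi>2" using Q P unfolding Q_def by (meson order.antisym)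
    have "?F 0 \<noteq> -\<infinity>" using z by (intro Phi_disc_neq_MInf) simp
    then have "?F \<xi>1 \<noteq> -\<infinity>" using Q P by (auto simp: Q_def)
    then have "?F \<xi>1 < ?F (midpoint \<xi>1 \<xi>2)" by (rule Phi_disc_less_midpoint[OF net \<alpha> p P(1,2) ne eq])
    moreover have "midpoint \<xi>1 \<xi>2 \<in> ?P"
      using closed_segment_subset[OF P(1,2) polyt_convex] midpoint_in_closed_segment by blast
    ultimately show False using Q by (auto simp: Q_def not_le[symmetric])
  qed
  moreover have "\<exists>\<xi>. Q \<xi>" using Phi_disc_attains_max[OF net \<alpha> z p(1)] by (auto simp: Q_def)
  ultimately have "Q (THE \<xi>. Q \<xi>)" by (metis theI)
  then show "xi_max p N \<alpha> v z \<in> ?P" "\<forall>\<eta>\<in>?P. ?F \<eta> \<le> ?F (xi_max p N \<alpha> v z)"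
    by (simp_all add: xi_max_def Q_def)
qed

section \<open>Comparison with the polytopes [(r, ..., r), Omega]\<close>

(* The paper's phi_p, so that Phi_p is the alpha-weighted sum of phi_p over the gaps. *)
definition powln :: "real \<Rightarrow> real \<Rightarrow> real" where
  "powln p t = (if p = 0 then ln t else t powr p)"

lemma powln_mono: "0 \<le> p \<Longrightarrow> 0 < s \<Longrightarrow> s \<le> t \<Longrightarrow> powln p s \<le> powln p t"
  by (auto simp: powln_def intro: powr_mono2)

lemma Phi_disc_le_powln:
  fixes v :: "nat \<Rightarrow> 'a::euclidean_space"
  assumes \<alpha>: "\<forall>i<N. \<alpha> i \<ge> 0" "(\<Sum>i<N. \<alpha> i) = 1" and p: "0 \<le> p" and b: "0 < b"
    and \<xi>: "\<xi> \<in> polyt N v z" and gap: "\<forall>i<N. z i - \<xi> \<bullet> v i \<le> b"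
  shows "Phi_disc p N \<alpha> v z \<xi> \<le> ereal (powln p b)"
proof (cases "p = 0")
  case False
  have "(\<Sum>i<N. (z i - \<xi> \<bullet> v i) powr p * \<alpha> i) \<le> (\<Sum>i<N. b powr p * \<alpha> i)"
    using \<xi> gap \<alpha> p by (intro sum_mono mult_right_mono powr_mono2) (auto simp: polyt_def)
  also have "\<dots> = b powr p" by (simp add: sum_distrib_left[symmetric] \<alpha>)
  finally show ?thesis using False by (simp add: Phi_disc_def powln_def)
next
  case True
  show ?thesis
  proof (cases "\<forall>i<N. z i - \<xi> \<bullet> v i > 0")
    case pos: True
    have "(\<Sum>i<N. \<alpha> i * ln (z i - \<xi> \<bullet> v i)) \<le> (\<Sum>i<N. \<alpha> i * ln b)"
      using gap \<alpha> pos b by (intro sum_mono mult_left_mono) auto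
    also have "\<dots> = ln b" by (simp add: sum_distrib_right[symmetric] \<alpha>)
    finally show ?thesis using True pos by (simp add: Phi_disc_def powln_def)
  qed (use True in \<open>auto simp: Phi_disc_def\<close>)
qed

lemma Phi_disc_xi_max_le:
  fixes v :: "nat \<Rightarrow> 'a::euclidean_space"
  assumes unit: "\<forall>i<N. norm (v i) = 1" and net: "half_net N v"
    and \<alpha>: "\<forall>i<N. \<alpha> i > 0" "(\<Sum>i<N. \<alpha> i) = 1" and p: "0 \<le> p" "p < 1" and r: "0 < r"
  shows "Phi_disc p N \<alpha> v (\<lambda>_. r) (xi_max p N \<alpha> v (\<lambda>_. r)) \<le> ereal (powln p (3 * r))"
proof -
  define \<xi> where "\<xi> = xi_max p N \<alpha> v (\<lambda>_. r)"
  have \<xi>P: "\<xi> \<in> polyt N v (\<lambda>_. r)" unfolding \<xi>_def using \<alpha> r by (intro xi_max_maximises net p) auto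
  then have "norm \<xi> \<le> 2 * r" using polyt_subset_cball[OF net, of "\<lambda>_. r" r] by auto
  then have "r - \<xi> \<bullet> v i \<le> 3 * r" if "i < N" for i
    using norm_cauchy_schwarz[of "-\<xi>" "v i"] unit that by simp
  then show ?thesis unfolding \<xi>_def[symmetric] using \<alpha> p r \<xi>P
    by (intro Phi_disc_le_powln) (auto simp: less_imp_le)
qed

lemma chord_int_normalised_polyt:
  assumes q: "q > 0"
  obtains R where "R > 0"
    and "\<And>N (v :: nat \<Rightarrow> 'a::euclidean_space). \<forall>i<N. norm (v i) = 1 \<Longrightarrow> half_net N v
           \<Longrightarrow> \<exists>r. 0 < r \<and> r \<le> R \<and> chord_int q (polyt N v (\<lambda>_. r)) = 1"
proof -
  define e where "e = real DIM('a) + q - 1"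
  have e: "e > 0" using q DIM_positive[where 'a='a] unfolding e_def by linarith
  obtain L where L: "L > 0"
    and lower: "\<And>K::'a set. compact K \<Longrightarrow> convex K \<Longrightarrow> cball 0 1 \<subseteq> K \<Longrightarrow> K \<subseteq> cball 0 2
                  \<Longrightarrow> ennreal L \<le> chord_int q K"
    using chord_int_lower_bound[OF q] by blast
  have "\<exists>r. 0 < r \<and> r \<le> L powr (-1 / e) \<and> chord_int q (polyt N v (\<lambda>_. r)) = 1"
    if unit: "\<forall>i<N. norm (v i) = 1" and net: "half_net N v" for N and v :: "nat \<Rightarrow> 'a"
  proof -
    let ?K = "polyt N v (\<lambda>_. 1)"
    have K: "compact ?K" "convex ?K" "cball 0 1 \<subseteq> ?K" "?K \<subseteq> cball 0 2"
      using compact_polyt[OF net] polyt_convex cball_subset_polyt[OF unit]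
        polyt_subset_cball[OF net, of "\<lambda>_. 1" 1] by auto
    define C where "C = enn2real (chord_int q ?K)"
    have CK: "chord_int q ?K = ennreal C"
      using chord_int_finite[OF K q] by (simp add: C_def ennreal_enn2real_if)
    have "0 \<le> C" by (simp add: C_def)
    then have LC: "L \<le> C" using lower[OF K] by (simp add: CK)
    define r where "r = C powr (-1 / e)"
    have r: "r > 0" "r \<le> L powr (-1 / e)" using L LC e by (auto simp: r_def intro: powr_mono2')
    have "r powr e = C powr (-1)" using e by (simp add: r_def powr_powr)
    then have "r powr e * C = 1" using L LC by (simp add: powr_minus_divide)
    moreover have "chord_int q (polyt N v (\<lambda>_. r)) = ennreal (r powr e) * chord_int q ?K"
      using polyt_scaleR[OF r(1), of N v "\<lambda>_. 1"] chord_int_scaleR[OF K(1,2) r(1)] by (simp add: e_def)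
    ultimately show ?thesis using r L LC by (auto simp: CK ennreal_mult[symmetric])
  qed
  then show ?thesis using that[of "L powr (-1 / e)"] L by simp
qed

lemma Phi_disc_minimiser_le:
  fixes v :: "nat \<Rightarrow> 'a::euclidean_space"
  assumes unit: "\<forall>i<N. norm (v i) = 1" and net: "half_net N v"
    and \<alpha>: "\<forall>i<N. \<alpha> i > 0" "(\<Sum>i<N. \<alpha> i) = 1" and p: "0 \<le> p" "p < 1"
    and r: "0 < r" "chord_int q (polyt N v (\<lambda>_. r)) = 1"
    and min: "Phi_disc p N \<alpha> v z \<xi> = Inf {Phi_disc p N \<alpha> v z' (xi_max p N \<alpha> v z')
                                           | z'. chord_int q (polyt N v z') = 1}"
  shows "Phi_disc p N \<alpha> v z \<xi> \<le> ereal (powln p (3 * r))"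
proof -
  have "Phi_disc p N \<alpha> v z \<xi> \<le> Phi_disc p N \<alpha> v (\<lambda>_. r) (xi_max p N \<alpha> v (\<lambda>_. r))"
    unfolding min using r(2) by (intro Inf_lower) blast
  also have "\<dots> \<le> ereal (powln p (3 * r))" by (rule Phi_disc_xi_max_le[OF unit net \<alpha> p r(1)])
  finally show ?thesis .
qed

section \<open>Support functions and the normalised polytope\<close>

lemma supp_fun_scaleR_polyt:
  fixes v :: "nat \<Rightarrow> 'a::euclidean_space"
  assumes unit: "\<forall>i<N. norm (v i) = 1" and z: "\<forall>j<N. z j > 0" and c: "0 \<le> c" and i: "i < N"
  shows "0 \<le> supp_fun ((*\<^sub>R) c ` polyt N v z) (v i)"
    and "supp_fun ((*\<^sub>R) c ` polyt N v z) (v i) \<le> c * z i"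
    and "0 < c \<Longrightarrow> 0 < supp_fun ((*\<^sub>R) c ` polyt N v z) (v i)"
proof -
  define S where "S = (\<lambda>x. c * (x \<bullet> v i)) ` polyt N v z"
  have h: "supp_fun ((*\<^sub>R) c ` polyt N v z) (v i) = Sup S"
    by (simp add: supp_fun_def S_def image_image)
  have ub: "y \<le> c * z i" if "y \<in> S" for y
    using that i c by (auto simp: S_def polyt_def intro: mult_left_mono)
  then have bdd: "bdd_above S" by (rule bdd_aboveI)
  have "0 \<in> polyt N v z" using z by (auto simp: polyt_def less_imp_le)
  then have S0: "0 \<in> S" unfolding S_def by (rule image_eqI[rotated]) simp
  then show "0 \<le> supp_fun ((*\<^sub>R) c ` polyt N v z) (v i)" unfolding h by (rule cSup_upper[OF _ bdd])
  show "supp_fun ((*\<^sub>R) c ` polyt N v z) (v i) \<le> c * z i" unfolding h using S0 ub by (intro cSup_least) auto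
  assume "0 < c"
  define t where "t = Min (z ` {..<N})"
  have t: "t > 0" unfolding t_def using z i by (subst Min_gr_iff) auto
  have "(t *\<^sub>R v i) \<bullet> v j \<le> z j" if "j < N" for j
  proof -
    have "(t *\<^sub>R v i) \<bullet> v j \<le> norm (t *\<^sub>R v i) * norm (v j)" by (rule norm_cauchy_schwarz)
    also have "\<dots> = t" using unit i that t by simp
    also have "t \<le> z j" using that by (simp add: t_def)
    finally show ?thesis .
  qed
  moreover have "v i \<bullet> v i = 1" using unit i by (simp add: power2_norm_eq_inner[symmetric])
  ultimately have "c * t \<in> S" unfolding S_def polyt_def by (auto intro!: image_eqI[of _ _ "t *\<^sub>R v i"])
  then have "c * t \<le> Sup S" by (rule cSup_upper[OF _ bdd])
  then show "0 < supp_fun ((*\<^sub>R) c ` polyt N v z) (v i)" unfolding h using \<open>0 < c\<close> t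
    by (smt (verit) mult_pos_pos)
qed

lemma Phi_body_scaleR_polyt_le_powr:
  fixes v :: "nat \<Rightarrow> 'a::euclidean_space"
  assumes unit: "\<forall>i<N. norm (v i) = 1" and \<alpha>: "\<forall>i<N. \<alpha> i \<ge> 0" and z: "\<forall>i<N. z i > 0"
    and p: "0 < p" and c: "0 \<le> c"
  shows "Phi_body p N \<alpha> v ((*\<^sub>R) c ` polyt N v z) 0 \<le> c powr p * (\<Sum>i<N. z i powr p * \<alpha> i)"
proof -
  have "(\<Sum>i<N. supp_fun ((*\<^sub>R) c ` polyt N v z) (v i) powr p * \<alpha> i) \<le> (\<Sum>i<N. (c * z i) powr p * \<alpha> i)"
    using supp_fun_scaleR_polyt[OF unit z c] \<alpha> p by (intro sum_mono mult_right_mono powr_mono2) auto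
  also have "\<dots> = c powr p * (\<Sum>i<N. z i powr p * \<alpha> i)"
    unfolding sum_distrib_left using c z by (intro sum.cong) (auto simp: powr_mult mult.assoc)
  finally show ?thesis using p by (simp add: Phi_body_def)
qed

lemma Phi_body_scaleR_polyt_le_ln:
  fixes v :: "nat \<Rightarrow> 'a::euclidean_space"
  assumes unit: "\<forall>i<N. norm (v i) = 1" and \<alpha>: "\<forall>i<N. \<alpha> i \<ge> 0" "(\<Sum>i<N. \<alpha> i) = 1"
    and z: "\<forall>i<N. z i > 0" and c: "0 < c"
  shows "Phi_body 0 N \<alpha> v ((*\<^sub>R) c ` polyt N v z) 0 \<le> ln c + (\<Sum>i<N. \<alpha> i * ln (z i))"
proof -
  have "(\<Sum>i<N. \<alpha> i * ln (supp_fun ((*\<^sub>R) c ` polyt N v z) (v i))) \<le> (\<Sum>i<N. \<alpha> i * ln (c * z i))"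
    using supp_fun_scaleR_polyt[OF unit z less_imp_le[OF c]] \<alpha> c z
    by (intro sum_mono mult_left_mono) auto
  also have "\<dots> = (\<Sum>i<N. \<alpha> i * ln c) + (\<Sum>i<N. \<alpha> i * ln (z i))"
    unfolding sum.distrib[symmetric] using c z by (intro sum.cong) (auto simp: ln_mult distrib_left)
  also have "(\<Sum>i<N. \<alpha> i * ln c) = ln c" by (simp add: sum_distrib_right[symmetric] \<alpha>)
  finally show ?thesis by (simp add: Phi_body_def)
qed

lemma Phi_body_normalised_le:
  fixes v :: "nat \<Rightarrow> 'a::euclidean_space"
  assumes unit: "\<forall>i<N. norm (v i) = 1" and \<alpha>: "\<forall>i<N. \<alpha> i > 0" "(\<Sum>i<N. \<alpha> i) = 1"
    and z: "\<forall>i<N. z i > 0" and p: "0 \<le> p" and e: "p < e" and B: "0 < B"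
    and bound: "Phi_disc p N \<alpha> v z 0 \<le> ereal (powln p B)"
  shows "Phi_body p N \<alpha> v
      ((\<lambda>x. (if p = 0 then e powr (-1 / e)
             else (real_of_ereal (Phi_disc p N \<alpha> v z 0) / e) powr (1 / (e - p))) *\<^sub>R x)
        ` polyt N v z) 0
    \<le> (if p = 0 then ln (e powr (-1 / e)) + ln B else (B powr p / e) powr (p / (e - p)) * B powr p)"
proof (cases "p = 0")
  case True
  have "Phi_disc p N \<alpha> v z 0 = ereal (\<Sum>i<N. \<alpha> i * ln (z i))" using True z by (simp add: Phi_disc_def)
  then have "(\<Sum>i<N. \<alpha> i * ln (z i)) \<le> ln B" using bound True by (simp add: powln_def)
  moreover have "Phi_body 0 N \<alpha> v ((*\<^sub>R) (e powr (-1 / e)) ` polyt N v z) 0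
      \<le> ln (e powr (-1 / e)) + (\<Sum>i<N. \<alpha> i * ln (z i))"
    using \<alpha> z e True by (intro Phi_body_scaleR_polyt_le_ln unit) (auto simp: less_imp_le)
  ultimately show ?thesis using True by simp
next
  case False
  define E where "E = (\<Sum>i<N. z i powr p * \<alpha> i)"
  have PE: "Phi_disc p N \<alpha> v z 0 = ereal E" using False by (simp add: Phi_disc_def E_def)
  have E0: "0 \<le> E" unfolding E_def using \<alpha> by (intro sum_nonneg mult_nonneg_nonneg) auto
  have EB: "E \<le> B powr p" using bound False by (simp add: PE powln_def)
  define c where "c = (E / e) powr (1 / (e - p))"
  have "Phi_body p N \<alpha> v ((*\<^sub>R) c ` polyt N v z) 0 \<le> c powr p * E"
    unfolding E_def using \<alpha> z False p by (intro Phi_body_scaleR_polyt_le_powr unit) (auto simp: c_def)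
  also have "c powr p = (E / e) powr (p / (e - p))" by (simp add: c_def powr_powr)
  also have "(E / e) powr (p / (e - p)) * E \<le> (B powr p / e) powr (p / (e - p)) * B powr p"
    using E0 EB e p by (intro mult_mono powr_mono2 divide_right_mono) auto
  finally show ?thesis using False by (simp add: PE c_def)
qed

section \<open>The discretisation of mu\<close>

lemma inner_gt_half_if_dist_lt_1:
  fixes u w :: "'a::real_inner"
  assumes "norm u = 1" "norm w = 1" "dist u w < 1"
  shows "u \<bullet> w > 1/2"
proof -
  have "u \<bullet> u = 1" "w \<bullet> w = 1" using assms by (simp_all add: power2_norm_eq_inner[symmetric])
  then have "(norm (u - w))^2 = 2 - 2 * (u \<bullet> w)"
    by (simp add: power2_norm_eq_inner inner_diff_left inner_diff_right inner_commute)
  moreover have "(norm (u - w))^2 < 1" using assms by (simp add: dist_norm power_less_one_iff)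
  ultimately show ?thesis by simp
qed

lemma half_net_if_fine_cover:
  fixes U :: "nat \<Rightarrow> 'a::real_inner set"
  assumes U: "\<forall>i<N. U i \<subseteq> sphere 0 1 \<and> diameter (U i) < 1" and cover: "(\<Union>i<N. U i) = sphere 0 1"
    and v: "\<forall>i<N. v i \<in> U i"
  shows "half_net N v"
  unfolding half_net_def
proof
  fix u :: 'a assume u: "u \<in> sphere 0 1"
  then obtain i where i: "i < N" "u \<in> U i" using cover by blast
  have "U i \<subseteq> cball 0 1" "v i \<in> U i" using U v i sphere_cball by blast+
  then have "dist u (v i) \<le> diameter (U i)"
    using i(2) by (meson bounded_subset bounded_cball diameter_bounded_bound)
  also have "\<dots> < 1" using U i by blast
  finally have "dist u (v i) < 1" .
  moreover have "norm (v i) = 1" using U v i by fastforce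
  ultimately have "u \<bullet> v i > 1/2" using u by (intro inner_gt_half_if_dist_lt_1) auto
  then show "\<exists>i<N. u \<bullet> v i > 1/2" using i by blast
qed

lemma
  assumes "N m > 0"
  shows sum_alpha_w: "(\<Sum>i<N m. alpha_w \<mu> U N m i) = measure \<mu> (space \<mu>)"
    and alpha_w_pos: "measure \<mu> (space \<mu>) > 0 \<Longrightarrow> i < N m \<Longrightarrow> alpha_w \<mu> U N m i > 0"
proof -
  define S where "S = (\<Sum>j<N m. measure \<mu> (U m j) + 1 / (real (N m))\<^sup>2)"
  have S: "S > 0" unfolding S_def using assms by (intro sum_pos) (auto intro: add_nonneg_pos)
  have \<alpha>: "alpha_w \<mu> U N m i = measure \<mu> (space \<mu>) * (measure \<mu> (U m i) + 1 / (real (N m))\<^sup>2) / S" for i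
    by (simp add: alpha_w_def S_def)
  show "(\<Sum>i<N m. alpha_w \<mu> U N m i) = measure \<mu> (space \<mu>)"
    using S by (simp add: \<alpha> sum_divide_distrib[symmetric] sum_distrib_left[symmetric] S_def)
  show "measure \<mu> (space \<mu>) > 0 \<Longrightarrow> i < N m \<Longrightarrow> alpha_w \<mu> U N m i > 0"
    using S assms by (simp add: \<alpha> add_nonneg_pos)
qed

lemma partition_unit_net_weights:
  fixes \<mu> :: "'a::euclidean_space measure"
  assumes prob: "prob_space \<mu>" and m: "m \<ge> 1"
    and U: "\<forall>i<N m. U m i \<subseteq> sphere 0 1 \<and> diameter (U m i) < 1 / real m"
    and cover: "(\<Union>i<N m. U m i) = sphere 0 1" and v: "\<forall>i<N m. v m i \<in> U m i"
  shows "\<forall>i<N m. norm (v m i) = 1" and "half_net (N m) (v m)"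
    and "\<forall>i<N m. alpha_w \<mu> U N m i > 0" and "(\<Sum>i<N m. alpha_w \<mu> U N m i) = 1"
proof -
  show "\<forall>i<N m. norm (v m i) = 1" using U v by fastforce
  have "1 / real m \<le> 1" using m by simp
  then have "\<forall>i<N m. U m i \<subseteq> sphere 0 1 \<and> diameter (U m i) < 1"
    using U order.strict_trans2 by blast
  then show "half_net (N m) (v m)" using cover v by (rule half_net_if_fine_cover)
  have "N m \<noteq> 0" using cover by (intro notI) (simp add: eq_commute[of "{}"])
  then have "N m > 0" by simp
  moreover have "measure \<mu> (space \<mu>) = 1" using prob by (rule prob_space.prob_space)
  ultimately show "\<forall>i<N m. alpha_w \<mu> U N m i > 0" "(\<Sum>i<N m. alpha_w \<mu> U N m i) = 1"
    by (simp_all add: alpha_w_pos sum_alpha_w)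
qed

theorem lemma5p3:
  fixes \<mu> :: "'a::euclidean_space measure"
    and p q :: real
    and N :: "nat \<Rightarrow> nat"
    and U :: "nat \<Rightarrow> nat \<Rightarrow> 'a set"
    and v :: "nat \<Rightarrow> nat \<Rightarrow> 'a"
    and zs :: "nat \<Rightarrow> nat \<Rightarrow> real"
    and m0 :: nat
  assumes dim: "DIM('a) \<ge> 2"
    and p: "0 \<le> p" "p < 1"
    and q: "q > 0"
    and prob: "prob_space \<mu>"
    and borel: "sets \<mu> = sets (borel :: 'a measure)"
    and on_sphere: "emeasure \<mu> (UNIV - sphere 0 1) = 0"
    and not_hemi: "\<forall>u\<in>sphere (0::'a) 1. emeasure \<mu> {x \<in> sphere 0 1. x \<bullet> u < 0} > 0"
    and part_sets: "\<forall>m\<ge>1. \<forall>i<N m. U m i \<in> sets borel \<and> U m i \<subseteq> sphere 0 1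
                       \<and> diameter (U m i) < 1 / real m
                       \<and> (\<exists>T. openin (top_of_set (sphere 0 1)) T \<and> T \<noteq> {} \<and> T \<subseteq> U m i)"
    and part_disj: "\<forall>m\<ge>1. \<forall>i<N m. \<forall>j<N m. i \<noteq> j \<longrightarrow> U m i \<inter> U m j = {}"
    and part_cover: "\<forall>m\<ge>1. (\<Union>i<N m. U m i) = sphere 0 1"
    and v_in: "\<forall>m\<ge>1. \<forall>i<N m. v m i \<in> U m i"
    and v_gen: "\<forall>m\<ge>1. gen_pos (N m) (v m)"
    and m0: "m0 \<ge> 1"
    and z_pos: "\<forall>m\<ge>m0. \<forall>i<N m. zs m i > 0"
    and z_xi: "\<forall>m\<ge>m0. xi_max p (N m) (alpha_w \<mu> U N m) (v m) (zs m) = 0"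
    and z_Iq: "\<forall>m\<ge>m0. chord_int q (polyt (N m) (v m) (zs m)) = 1"
    and z_min: "\<forall>m\<ge>m0. Phi_disc p (N m) (alpha_w \<mu> U N m) (v m) (zs m) 0 =
                 Inf {Phi_disc p (N m) (alpha_w \<mu> U N m) (v m) z
                        (xi_max p (N m) (alpha_w \<mu> U N m) (v m) z)
                      | z. chord_int q (polyt (N m) (v m) z) = 1}"
  shows "\<exists>c0>0. \<forall>m\<ge>m0.
           Phi_body p (N m) (alpha_w \<mu> U N m) (v m)
             ((\<lambda>x. (if p = 0 then (real DIM('a) + q - 1) powr (-1 / (real DIM('a) + q - 1))
               else (real_of_ereal (Phi_disc p (N m) (alpha_w \<mu> U N m) (v m) (zs m) 0)
                       / (real DIM('a) + q - 1)) powr (1 / (real DIM('a) + q - p - 1)))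
               *\<^sub>R x) ` polyt (N m) (v m) (zs m)) 0 < c0"
proof -
  define e where "e = real DIM('a) + q - 1"
  have e: "p < e" using dim p q by (simp add: e_def)
  obtain R where R: "R > 0"
    and normalise: "\<And>N (v :: nat \<Rightarrow> 'a). \<forall>i<N. norm (v i) = 1 \<Longrightarrow> half_net N v
          \<Longrightarrow> \<exists>r. 0 < r \<and> r \<le> R \<and> chord_int q (polyt N v (\<lambda>_. r)) = 1"
    using chord_int_normalised_polyt[OF q] by blast
  define c where "c = (if p = 0 then ln (e powr (-1 / e)) + ln (3 * R)
                       else ((3 * R) powr p / e) powr (p / (e - p)) * (3 * R) powr p)"
  have bound: "Phi_body p (N m) (alpha_w \<mu> U N m) (v m)
          ((\<lambda>x. (if p = 0 then e powr (-1 / e)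
                 else (real_of_ereal (Phi_disc p (N m) (alpha_w \<mu> U N m) (v m) (zs m) 0) / e)
                        powr (1 / (e - p))) *\<^sub>R x) ` polyt (N m) (v m) (zs m)) 0 \<le> c"
    if m: "m \<ge> m0" for m
  proof -
    have m1: "m \<ge> 1" using m m0 by simp
    have "\<forall>i<N m. U m i \<subseteq> sphere 0 1 \<and> diameter (U m i) < 1 / real m"
      "(\<Union>i<N m. U m i) = sphere 0 1" "\<forall>i<N m. v m i \<in> U m i"
      using part_sets part_cover v_in m1 by blast+
    note data = partition_unit_net_weights[where N = N and U = U and v = v, OF prob m1 this]
    obtain r where r: "0 < r" "r \<le> R" "chord_int q (polyt (N m) (v m) (\<lambda>_. r)) = 1"
      using normalise[OF data(1,2)] by blast
    have "Phi_disc p (N m) (alpha_w \<mu> U N m) (v m) (zs m) 0 \<le> ereal (powln p (3 * r))"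
      by (rule Phi_disc_minimiser_le[OF data p r(1,3) z_min[rule_format, OF m]])
    also have "\<dots> \<le> ereal (powln p (3 * R))" using r p by (simp add: powln_mono)
    finally show ?thesis
      unfolding c_def using z_pos m R by (intro Phi_body_normalised_le[OF data(1,3,4) _ p(1) e]) auto
  qed
  have exponent: "real DIM('a) + q - p - 1 = e - p" by (simp add: e_def)
  show ?thesis unfolding exponent e_def[symmetric]
    using bound by (intro exI[of _ "\<bar>c\<bar> + 1"]) fastforce
qed

end
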